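(* Let $D=(V,A)$ be a digraph of order $n$. Then Min-Greedy always finds an acyclic set in $D$ of size at least $\sum_{v\in V}\left(d^+(v)+1\right)^{-1}$, where $d^+(v)$ is the outdegree of $v$ in $D$.
   Context: A digraph $D=(V,A)$ consists of a finite vertex set $V$ and an irreflexive relation $A\subseteq V\times V$ (the arcs); its order is $|V|$. For a vertex $v$, its out-neighborhood is $N^+(v)=\{u\in V\setminus\{v\} : (v,u)\in A\}$ and its outdegree is $d^+(v)=|N^+(v)|$; when computed in a digraph $D_i$ these are written $N^+_{D_i}(v)$, $d^+_{D_i}(v)$. For $U\subseteq V$, the induced subdigraph $D[U]$ has vertex set $U$ and arc set $A\cap(U\times U)$. A cycle is a sequence of $k\ge 1$ arcs $(v_1,w_1)\cdots(v_k,w_k)$ with $w_i=v_{i+1}$ for $1\le i<k$, all $v_i$ distinct, and $w_k=v_1$ (so a pair of opposite arcs is a cycle). $U\subseteq V$ is an acyclic set if $D[U]$ has no cycle. Min-Greedy: start with $D_1=D$; while $D_i$ has a nonempty vertex set, choose a vertex $v_i$ of minimum outdegree in $D_i$ (ties broken arbitrarily), and let $D_{i+1}$ be obtained from $D_i$ by deleting $v_i$ together with $N^+_{D_i}(v_i)$. The output is the set $S=\{v_1,\dots,v_r\}$ of all chosen vertices (this set is an acyclic set of $D$). *)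

theory Defs
  imports Complex_Main "Graph_Theory.Digraph_Component"
begin

definition out_neighborhood :: "('a, 'b) pre_digraph \<Rightarrow> 'a \<Rightarrow> 'a set" where
  "out_neighborhood D v = {u \<in> verts D - {v}. v \<rightarrow>\<^bsub>D\<^esub> u}"

text \<open>The locale \<^locale>\<open>digraph\<close> excludes loops and parallel arcs, so the library's
  \<^const>\<open>out_degree\<close>, which counts arcs, counts out-neighbors.\<close>

lemma (in digraph) out_degree_eq_card_out_neighborhood:
  "out_degree G v = card (out_neighborhood G v)"
proof -
  have inj: "inj_on (head G) (out_arcs G v)"
    by (rule inj_onI) (auto intro: no_multi_arcs simp: arc_to_ends_def)
  have "head G ` out_arcs G v = out_neighborhood G v"
    using no_loops
    by (force simp: out_neighborhood_def arcs_ends_conv image_iff)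
  with card_image[OF inj] show ?thesis
    by (simp add: out_degree_def)
qed

definition acyclic_set :: "('a, 'b) pre_digraph \<Rightarrow> 'a set \<Rightarrow> bool" where
  "acyclic_set D U \<longleftrightarrow> U \<subseteq> verts D \<and> \<not> (\<exists>p. pre_digraph.cycle (D \<restriction> U) p)"

text \<open>A state of Min-Greedy consists of the remaining digraph and the set of vertices chosen
  so far. The step relation is nondeterministic: any vertex of minimum outdegree may be chosen.
  The loop guard is implicit, since no vertex can be chosen from an empty vertex set.\<close>

inductive min_greedy_step ::
    "('a, 'b) pre_digraph \<times> 'a set \<Rightarrow> ('a, 'b) pre_digraph \<times> 'a set \<Rightarrow> bool" where
  "is_arg_min (out_degree H) (\<lambda>u. u \<in> verts H) v \<Longrightarrow>
   min_greedy_step (H, S) (H \<restriction> (verts H - insert v (out_neighborhood H v)), insert v S)"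

definition min_greedy_output :: "('a, 'b) pre_digraph \<Rightarrow> 'a set \<Rightarrow> bool" where
  "min_greedy_output D S \<longleftrightarrow>
     (\<exists>H. min_greedy_step\<^sup>*\<^sup>* (D, {}) (H, S) \<and> verts H = {})"

end

theory Submission
  imports Defs
begin

text \<open>The vertex set deleted in one step consists of \<open>d + 1\<close> vertices, where \<open>d\<close> is the minimum
  outdegree of the current digraph, so it carries weight at most \<open>(d + 1) \<sqdot> (d + 1)\<^sup>-\<^sup>1 = 1\<close>, and
  the weights of the remaining vertices do not decrease. Hence the number of chosen vertices plus
  the weight of the current digraph never decreases. No arc leads from a chosen vertex to a
  remaining one, so every arc between chosen vertices goes back in the order of choice.\<close>

text \<open>A strictly decreasing rank makes every nonempty walk inside \<open>U\<close> end
  strictly below its start, so no walk can close up into a cycle.\<close>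

lemma acyclic_set_if_rank:
  fixes f :: "'a \<Rightarrow> nat"
  assumes "U \<subseteq> verts D"
    and rank: "\<And>e. e \<in> arcs D \<Longrightarrow> tail D e \<in> U \<Longrightarrow> head D e \<in> U \<Longrightarrow> f (head D e) < f (tail D e)"
  shows "acyclic_set D U"
proof -
  \<comment> \<open>The start \<open>u\<close> stays arbitrary for the induction; the disjunct
    \<open>p = []\<close> covers the empty tail of a one-arc walk.\<close>
  have walk: "p = [] \<or> f v < f u"
    if "pre_digraph.cas (D \<restriction> U) u p v" "set p \<subseteq> arcs (D \<restriction> U)" for u p v
    using that
  proof (induction p arbitrary: u)
    case (Cons e p)
    then have e: "tail D e = u" "f (head D e) < f u" and "pre_digraph.cas (D \<restriction> U) (head D e) p v"
      using rank[of e] by (auto simp: pre_digraph.cas.simps)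
    with Cons.IH Cons.prems(2) have "p = [] \<or> f v < f (head D e)"
      by auto
    with e \<open>pre_digraph.cas (D \<restriction> U) (head D e) p v\<close> show ?case
      by (auto simp: pre_digraph.cas.simps)
  qed simp
  have "\<not> pre_digraph.cycle (D \<restriction> U) p" for p
    using walk by (fastforce simp: pre_digraph.cycle_def pre_digraph.awalk_def)
  with assms(1) show ?thesis
    by (simp add: acyclic_set_def)
qed

lemma (in digraph) digraph_induce_subgraph: "W \<subseteq> verts G \<Longrightarrow> digraph (G \<restriction> W)"
  by (rule digraphI_induced[OF induced_induce])

lemma (in digraph) induce_verts [simp]: "G \<restriction> verts G = G"
  by (auto simp: induce_subgraph_def intro!: pre_digraph.equality)

lemma induce_subgraph_induce_subgraph: "W \<subseteq> U \<Longrightarrow> (D \<restriction> U) \<restriction> W = D \<restriction> W"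
  by (auto simp: induce_subgraph_def)

lemma (in digraph) out_degree_induce_le: "out_degree (G \<restriction> W) v \<le> out_degree G v"
  unfolding out_degree_def by (rule card_mono) (auto simp: out_arcs_def)

text \<open>The bound of the theorem as a function of the digraph, so that it can serve as a
  potential on the remaining digraphs.\<close>

definition degree_weight :: "('a, 'b) pre_digraph \<Rightarrow> real" where
  "degree_weight D = (\<Sum>v\<in>verts D. inverse (real (out_degree D v) + 1))"

lemma (in digraph) degree_weight_min_degree_step:
  assumes "is_arg_min (out_degree G) (\<lambda>u. u \<in> verts G) v"
  shows "degree_weight G
    \<le> degree_weight (G \<restriction> (verts G - insert v (out_neighborhood G v))) + 1"
proof -
  let ?R = "insert v (out_neighborhood G v)"
  let ?w = "\<lambda>H u. inverse (real (out_degree H u) + 1)"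
  have min: "out_degree G v \<le> out_degree G u" if "u \<in> verts G" for u
    using assms that by (auto simp: is_arg_min_def not_less)
  have sub: "?R \<subseteq> verts G"
    using assms by (auto simp: is_arg_min_def out_neighborhood_def)
  have fin: "finite (out_neighborhood G v)"
    using finite_subset[OF sub finite_verts] by simp
  have card: "card ?R = out_degree G v + 1"
    \<comment> \<open>The summand 1 is \<open>v\<close> itself, which never lies in its own
      out-neighborhood.\<close>
    using fin by (simp add: out_degree_eq_card_out_neighborhood) (simp add: out_neighborhood_def)
  have "(\<Sum>u\<in>?R. ?w G u) \<le> (\<Sum>u\<in>?R. ?w G v)"
    using min sub by (intro sum_mono le_imp_inverse_le) auto
  also have "\<dots> = 1"
    unfolding sum_constant card by (simp add: field_simps)
  finally have "(\<Sum>u\<in>?R. ?w G u) \<le> 1" .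
  \<comment> \<open>Passing to an induced subdigraph can only lower outdegrees, hence only raise the
    inverses.\<close>
  moreover have "(\<Sum>u\<in>verts G - ?R. ?w G u) \<le> degree_weight (G \<restriction> (verts G - ?R))"
    unfolding degree_weight_def
    by (auto intro!: sum_mono le_imp_inverse_le out_degree_induce_le)
  moreover have "degree_weight G = (\<Sum>u\<in>verts G - ?R. ?w G u) + (\<Sum>u\<in>?R. ?w G u)"
    unfolding degree_weight_def using sub by (intro sum.subset_diff) auto
  ultimately show ?thesis
    by linarith
qed

text \<open>The chosen vertex is always among the deleted ones, so the number of vertices is a
  measure for the two inductions below.\<close>

lemma min_greedy_step_digraph:
  assumes "min_greedy_step (H, S) (H', S')" "digraph H"
  shows "digraph H'" "card (verts H') < card (verts H)"
proof -
  interpret digraph H by fact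
  obtain v where v: "v \<in> verts H" and H': "H' = H \<restriction> (verts H - insert v (out_neighborhood H v))"
    using assms(1) by (auto simp: min_greedy_step.simps is_arg_min_def)
  show "digraph H'"
    unfolding H' by (rule digraph_induce_subgraph) auto
  show "card (verts H') < card (verts H)"
    unfolding H' using v by (auto intro!: psubset_card_mono)
qed

lemma termip_min_greedy_step: "digraph H \<Longrightarrow> termip min_greedy_step (H, S)"
proof (induction "card (verts H)" arbitrary: H S rule: less_induct)
  case less
  show ?case
    by (rule accpI) (use less min_greedy_step_digraph in fastforce)
qed

text \<open>Termination alone would allow a run to get stuck early. This cannot happen, since a
  nonempty finite vertex set has a vertex of minimum outdegree.\<close>

lemma min_greedy_reaches_empty:
  "digraph H \<Longrightarrow> \<exists>H' S'. min_greedy_step\<^sup>*\<^sup>* (H, S) (H', S') \<and> verts H' = {}"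
proof (induction "card (verts H)" arbitrary: H S rule: less_induct)
  case less
  show ?case
  proof (cases "verts H = {}")
    case False
    interpret digraph H by fact
    obtain v where min: "is_arg_min (out_degree H) (\<lambda>u. u \<in> verts H) v"
      using ex_is_arg_min_if_finite[OF finite_verts False] by auto
    obtain H' S' where step: "min_greedy_step (H, S) (H', S')"
      using min_greedy_step.intros[OF min] by (rule that)
    from less.hyps[OF min_greedy_step_digraph(2,1)[OF step less.prems]] obtain H'' S''
      where "min_greedy_step\<^sup>*\<^sup>* (H', S') (H'', S'')" "verts H'' = {}"
      by blast
    with step show ?thesis
      by (meson converse_rtranclp_into_rtranclp)
  qed blast
qed

text \<open>The rank \<open>f\<close> records the order in which the vertices of \<open>S\<close> were chosen.\<close>

definition greedy_invariant ::
    "('a, 'b) pre_digraph \<Rightarrow> ('a, 'b) pre_digraph \<Rightarrow> 'a set \<Rightarrow> ('a \<Rightarrow> nat) \<Rightarrow> bool" where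
  "greedy_invariant D H S f \<longleftrightarrow>
     verts H \<subseteq> verts D \<and> H = D \<restriction> verts H \<and> S \<subseteq> verts D - verts H \<and>
     (\<forall>u\<in>S. f u < card S) \<and>
     (\<forall>e\<in>arcs D. tail D e \<in> S \<longrightarrow>
        head D e \<notin> verts H \<and> (head D e \<in> S \<longrightarrow> f (head D e) < f (tail D e))) \<and>
     degree_weight D \<le> degree_weight H + real (card S)"

text \<open>The new vertex \<open>v\<close> receives rank \<open>card S\<close>, which exceeds all
  earlier ranks. Deleting its out-neighbors keeps arcs from \<open>v\<close> out of the remaining
  digraph.\<close>

lemma (in digraph) greedy_invariant_step:
  assumes inv: "greedy_invariant G H S f" and step: "min_greedy_step (H, S) (H', S')"
  shows "\<exists>f'. greedy_invariant G H' S' f'"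
proof -
  obtain v where min: "is_arg_min (out_degree H) (\<lambda>u. u \<in> verts H) v"
    and H': "H' = H \<restriction> (verts H - insert v (out_neighborhood H v))" and S': "S' = insert v S"
    using step by (auto elim: min_greedy_step.cases)
  define W where "W = verts H - insert v (out_neighborhood H v)"
  have sub: "verts H \<subseteq> verts G" and H: "H = G \<restriction> verts H" and S: "S \<subseteq> verts G - verts H"
    and f: "\<And>u. u \<in> S \<Longrightarrow> f u < card S"
    and arc: "\<And>e. e \<in> arcs G \<Longrightarrow> tail G e \<in> S \<Longrightarrow> head G e \<notin> verts H"
      "\<And>e. e \<in> arcs G \<Longrightarrow> tail G e \<in> S \<Longrightarrow> head G e \<in> S \<Longrightarrow> f (head G e) < f (tail G e)"
    and wt: "degree_weight G \<le> degree_weight H + real (card S)"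
    using inv unfolding greedy_invariant_def by blast+
  have v: "v \<in> verts H"
    using min by (simp add: is_arg_min_def)
  have "v \<notin> S" using v S by blast
  have "finite S" using S finite_subset[OF _ finite_verts] by blast
  have card: "card S' = Suc (card S)"
    using \<open>v \<notin> S\<close> \<open>finite S\<close> by (simp add: S')
  interpret H: digraph H
    using digraph_induce_subgraph[OF sub] H by simp
  have H'W: "H' = G \<restriction> W"
  proof -
    have "H' = (G \<restriction> verts H) \<restriction> W"
      using H by (simp add: H' W_def)
    also have "\<dots> = G \<restriction> W"
      by (rule induce_subgraph_induce_subgraph) (auto simp: W_def)
    finally show ?thesis .
  qed
  have out_v: "head G e \<notin> W" if "e \<in> arcs G" "tail G e = v" for e
  proof
    assume "head G e \<in> W"
    then have h: "head G e \<in> verts H" "head G e \<noteq> v" "head G e \<notin> out_neighborhood H v"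
      by (auto simp: W_def)
    \<comment> \<open>These equations carry the arc \<open>e\<close> of \<open>G\<close> over to
      \<open>H\<close>, where the out-neighborhood of \<open>v\<close> is taken.\<close>
    have "arcs (G \<restriction> verts H) = arcs H" "tail H = tail G" "head H = head G"
      using H by (metis, metis induce_subgraph_tail, metis induce_subgraph_head)
    with that h v have "e \<in> arcs H" "tail H e = v" "head H e = head G e"
      by auto
    then have "v \<rightarrow>\<^bsub>H\<^esub> head G e"
      by (auto simp: arcs_ends_conv intro!: rev_image_eqI)
    with h show False
      by (simp add: out_neighborhood_def)
  qed
  have "degree_weight H \<le> degree_weight H' + 1"
    using H.degree_weight_min_degree_step[OF min] by (simp add: H')
  with wt card have "degree_weight G \<le> degree_weight H' + real (card S')"
    by simp
  moreover have "head G e \<notin> W \<and>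
      (head G e \<in> S' \<longrightarrow> (f(v := card S)) (head G e) < (f(v := card S)) (tail G e))"
    if e: "e \<in> arcs G" "tail G e \<in> S'" for e
  \<comment> \<open>An arc from \<open>v\<close> to a chosen vertex ends in \<open>S\<close>, as
    loops are excluded, so the rank drops. An arc from \<open>S\<close> cannot end in
    \<open>v\<close>, which was still in \<open>H\<close>, so the old ranks decide.\<close>
  proof (cases "tail G e = v")
    case True
    then show ?thesis
      using out_v[OF e(1)] f no_loops[OF e(1)] by (auto simp: S')
  next
    case False
    with e(2) have t: "tail G e \<in> S" by (simp add: S')
    with arc[OF e(1)] v have "head G e \<noteq> v" "head G e \<notin> W"
      by (auto simp: W_def)
    with arc(2)[OF e(1) t] False show ?thesis
      by (auto simp: S')
  qed
  moreover have "W \<subseteq> verts G" "S' \<subseteq> verts G - W"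
    using sub S v by (auto simp: W_def S')
  moreover have "\<forall>u\<in>S'. (f(v := card S)) u < card S'"
    unfolding card using f by (auto simp: S' less_Suc_eq)
  ultimately have "greedy_invariant G H' S' (f(v := card S))"
    unfolding greedy_invariant_def by (simp add: H'W)
  then show ?thesis by - (rule exI)
qed

lemma (in digraph) greedy_invariant_reachable:
  assumes "min_greedy_step\<^sup>*\<^sup>* (G, {}) (H, S)"
  shows "\<exists>f. greedy_invariant G H S f"
  using assms
proof (induction rule: rtranclp_induct2)
  case refl
  \<comment> \<open>With no vertex chosen, any \<open>f\<close> works and the weight inequality is
    an equality.\<close>
  show ?case
    by (simp add: greedy_invariant_def)
next
  case step
  then show ?case
    using greedy_invariant_step by blast
qed

text \<open>Termination for every tie-breaking and existence of an output keep the last conjunct,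
  which ranges over all outputs, from being vacuous.\<close>

theorem theorem4:
  fixes D :: "('a, 'b) pre_digraph"
  assumes "digraph D"
  shows "termip min_greedy_step (D, {})
    \<and> (\<exists>S. min_greedy_output D S)
    \<and> (\<forall>S. min_greedy_output D S \<longrightarrow>
          acyclic_set D S
          \<and> real (card S) \<ge> (\<Sum>v\<in>verts D. inverse (real (out_degree D v) + 1)))"
proof -
  interpret digraph D by fact
  have "acyclic_set D S \<and> real (card S) \<ge> degree_weight D" if out: "min_greedy_output D S" for S
  proof -
    obtain H f where "verts H = {}" and inv: "greedy_invariant D H S f"
      using out greedy_invariant_reachable unfolding min_greedy_output_def by blast
    \<comment> \<open>The potential is used up at the end, so \<open>card S\<close> alone bounds the
      initial weight.\<close>
    then have "degree_weight H = 0"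
      by (simp add: degree_weight_def)
    moreover have "acyclic_set D S"
      by (rule acyclic_set_if_rank[where f = f]) (use inv in \<open>auto simp: greedy_invariant_def\<close>)
    ultimately show ?thesis
      using inv by (simp add: greedy_invariant_def)
  qed
  moreover have "\<exists>S. min_greedy_output D S"
    using min_greedy_reaches_empty[OF assms] unfolding min_greedy_output_def by blast
  ultimately show ?thesis
    using termip_min_greedy_step[OF assms] by (simp add: degree_weight_def)
qed

end
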